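(* Let $n\ge2$ and let $Q=[q_{ij}]\in\mathbb{R}^{n\times n}$ be an orthogonal matrix ($QQ^T=I$) such that $q_{ij}\neq0$ if and only if $j\le i+1$ (i.e. $Q$ has the zero-nonzero pattern of a lower Hessenberg matrix with all entries on and below the superdiagonal nonzero). Then every super pattern of $\operatorname{sgn}(Q)$ allows orthogonality.
   Context: A sign pattern is a $(0,1,-1)$-matrix; $\operatorname{sgn}(A)$ is the entrywise sign of $A$. An $n\times n$ sign pattern $S$ allows orthogonality if there is a real orthogonal matrix $Q$ with $\operatorname{sgn}(Q)=S$. For sign patterns $S=[s_{ij}]$, $R=[r_{ij}]$ of the same size, $S_{\vec R}$ is the sign pattern with $(i,j)$-entry $s_{ij}$ if $s_{ij}\ne0$ and $r_{ij}$ otherwise; a super pattern of $S$ is any sign pattern of the form $S_{\vec R}$. *)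

theory Defs
  imports "Jordan_Normal_Form.Matrix"
begin

definition sign_pattern :: "real mat \<Rightarrow> bool" where
  "sign_pattern S \<longleftrightarrow> elements_mat S \<subseteq> {0, 1, -1}"

definition sgn_mat :: "real mat \<Rightarrow> real mat" where
  "sgn_mat A = map_mat sgn A"

text \<open>The predicate \<open>orthogonal_mat\<close> of \<open>Matrix\<close> only asks for nonzero, pairwise orthogonal
  columns, without normalization.\<close>
definition orthonormal_mat :: "real mat \<Rightarrow> bool" where
  "orthonormal_mat Q \<longleftrightarrow> square_mat Q \<and> Q * transpose_mat Q = 1\<^sub>m (dim_row Q)"

definition allows_orthogonality :: "real mat \<Rightarrow> bool" where
  "allows_orthogonality S \<longleftrightarrow> (\<exists>Q. orthonormal_mat Q \<and> sgn_mat Q = S)"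

text \<open>The pattern written \<open>S\<close> with subscript arrow-\<open>R\<close>: zeros of \<open>S\<close> are filled from \<open>R\<close>, which may itself be zero there.\<close>
definition overlay :: "real mat \<Rightarrow> real mat \<Rightarrow> real mat" where
  "overlay S R = mat (dim_row S) (dim_col S)
     (\<lambda>(i, j). if S $$ (i, j) \<noteq> 0 then S $$ (i, j) else R $$ (i, j))"

definition super_pattern :: "real mat \<Rightarrow> real mat \<Rightarrow> bool" where
  "super_pattern T S \<longleftrightarrow>
     (\<exists>R. R \<in> carrier_mat (dim_row S) (dim_col S) \<and> sign_pattern R \<and> T = overlay S R)"

end

theory Submission
  imports Defs "Jordan_Normal_Form.Determinant"
begin

text \<open>Let \<open>R\<close> be the pattern that fills the zeros of \<open>sgn Q\<close> and \<open>A(e) = Q + e R\<close>, so that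
  \<open>N(e) = A(e) Q\<^sup>T\<close> tends to the identity as \<open>e\<close> tends to \<open>0\<close> from the right. Changing only the
  strictly lower triangular part of \<open>N\<close> one obtains a matrix \<open>M\<close>, still tending to the identity,
  with pairwise orthogonal rows: the unknown entries of row \<open>m\<close> solve a linear system whose matrix,
  the leading \<open>m \<times> m\<close> block of the rows already treated, tends to the identity. Then \<open>B = M Q\<close> has
  orthogonal rows and tends to \<open>Q\<close>, and row \<open>i\<close> of \<open>B - A = (M - N) Q\<close> is a combination of the
  rows of \<open>Q\<close> above row \<open>i\<close>. In a Hessenberg matrix these vanish wherever row \<open>i\<close> does, so there
  \<open>B\<close> agrees with \<open>e R\<close>. Normalizing the rows of \<open>B\<close> does not change signs.\<close>

definition tendsto_mat :: "('a \<Rightarrow> 'b::topological_space mat) \<Rightarrow> 'b mat \<Rightarrow> 'a filter \<Rightarrow> bool" where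
  "tendsto_mat A L F \<longleftrightarrow> (\<forall>x. dim_row (A x) = dim_row L \<and> dim_col (A x) = dim_col L) \<and>
     (\<forall>i<dim_row L. \<forall>j<dim_col L. ((\<lambda>x. A x $$ (i, j)) \<longlongrightarrow> L $$ (i, j)) F)"

lemma tendsto_mat_carrier:
  assumes "tendsto_mat A L F" "L \<in> carrier_mat m n"
  shows "A x \<in> carrier_mat m n"
  using assms by (auto simp: tendsto_mat_def intro: carrier_matI)

lemma tendsto_mat_index:
  assumes "tendsto_mat A L F" "L \<in> carrier_mat m n" "i < m" "j < n"
  shows "((\<lambda>x. A x $$ (i, j)) \<longlongrightarrow> L $$ (i, j)) F"
  using assms by (auto simp: tendsto_mat_def)

lemma tendsto_mat_const: "tendsto_mat (\<lambda>x. A) A F"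
  by (simp add: tendsto_mat_def)

lemma tendsto_mat_transpose:
  assumes "tendsto_mat A L F"
  shows "tendsto_mat (\<lambda>x. (A x)\<^sup>T) L\<^sup>T F"
  using assms by (simp add: tendsto_mat_def)

lemma tendsto_mat_smult:
  fixes L :: "'b::real_normed_algebra mat"
  assumes "(c \<longlongrightarrow> c\<^sub>0) F" "tendsto_mat A L F"
  shows "tendsto_mat (\<lambda>x. c x \<cdot>\<^sub>m A x) (c\<^sub>0 \<cdot>\<^sub>m L) F"
  using assms by (simp add: tendsto_mat_def tendsto_mult)

lemma tendsto_mat_add:
  fixes L K :: "'b::topological_monoid_add mat"
  assumes "tendsto_mat A L F" "tendsto_mat B K F" "dim_row L = dim_row K" "dim_col L = dim_col K"
  shows "tendsto_mat (\<lambda>x. A x + B x) (L + K) F"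
  using assms by (simp add: tendsto_mat_def tendsto_add)

lemma tendsto_mat_mult:
  fixes L K :: "'b::real_normed_algebra mat"
  assumes "tendsto_mat A L F" "tendsto_mat B K F" "dim_col L = dim_row K"
  shows "tendsto_mat (\<lambda>x. A x * B x) (L * K) F"
  using assms by (auto simp: tendsto_mat_def scalar_prod_def intro!: tendsto_sum tendsto_mult)

lemma tendsto_det:
  fixes L :: "'b::{real_normed_algebra, comm_ring_1} mat"
  assumes A: "tendsto_mat A L F" and L: "L \<in> carrier_mat n n"
  shows "((\<lambda>x. det (A x)) \<longlongrightarrow> det L) F"
proof -
  have "((\<lambda>x. \<Sum>p | p permutes {0..<n}. signof p * (\<Prod>i=0..<n. A x $$ (i, p i)))
      \<longlongrightarrow> (\<Sum>p | p permutes {0..<n}. signof p * (\<Prod>i=0..<n. L $$ (i, p i)))) F"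
    by (intro tendsto_sum tendsto_mult tendsto_const tendsto_prod tendsto_mat_index[OF A L])
      (use permutes_in_image in fastforce)+
  then show ?thesis
    by (simp add: det_def'[OF L] det_def'[OF tendsto_mat_carrier[OF A L]])
qed

lemma tendsto_mat_mat_delete:
  assumes A: "tendsto_mat A L F" and ij: "i < dim_row L" "j < dim_col L"
  shows "tendsto_mat (\<lambda>x. mat_delete (A x) i j) (mat_delete L i j) F"
  using assms by (auto simp: tendsto_mat_def mat_delete_def)

lemma tendsto_mat_adj_mat:
  fixes L :: "'b::{real_normed_algebra, comm_ring_1} mat"
  assumes A: "tendsto_mat A L F" and L: "L \<in> carrier_mat n n"
  shows "tendsto_mat (\<lambda>x. adj_mat (A x)) (adj_mat L) F"
proof -
  have "((\<lambda>x. cofactor (A x) j i) \<longlongrightarrow> cofactor L j i) F" if "i < n" "j < n" for i j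
  proof -
    have "tendsto_mat (\<lambda>x. mat_delete (A x) j i) (mat_delete L j i) F"
      using tendsto_mat_mat_delete[OF A] L that by simp
    then show ?thesis
      unfolding cofactor_def
      by (rule tendsto_mult[OF tendsto_const tendsto_det[OF _ mat_delete_carrier[OF L]]])
  qed
  then show ?thesis using A L by (simp add: tendsto_mat_def adj_mat_def)
qed

lemma tendsto_mat_solution:
  fixes L X\<^sub>0 :: "'b::real_normed_field mat"
  assumes A: "tendsto_mat A L F" and B: "tendsto_mat B (L * X\<^sub>0) F"
    and L: "L \<in> carrier_mat n n" and X\<^sub>0: "X\<^sub>0 \<in> carrier_mat n k" and "det L \<noteq> 0"
  obtains X where "tendsto_mat X X\<^sub>0 F" and "\<forall>\<^sub>F x in F. A x * X x = B x"
proof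
  define X where "X x = inverse (det (A x)) \<cdot>\<^sub>m (adj_mat (A x) * B x)" for x
  have det: "((\<lambda>x. det (A x)) \<longlongrightarrow> det L) F" by (rule tendsto_det[OF A L])
  have "adj_mat L * (L * X\<^sub>0) = det L \<cdot>\<^sub>m X\<^sub>0"
    using adj_mat[OF L] L X\<^sub>0
    by (simp flip: assoc_mult_mat add: mult_smult_assoc_mat[OF one_carrier_mat X\<^sub>0])
  then have "inverse (det L) \<cdot>\<^sub>m (adj_mat L * (L * X\<^sub>0)) = X\<^sub>0"
    using \<open>det L \<noteq> 0\<close> by (intro eq_matI) auto
  moreover have "tendsto_mat X (inverse (det L) \<cdot>\<^sub>m (adj_mat L * (L * X\<^sub>0))) F"
    unfolding X_def using A B L det adj_mat(1)[OF L] \<open>det L \<noteq> 0\<close>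
    by (intro tendsto_mat_smult tendsto_mat_mult tendsto_mat_adj_mat tendsto_inverse) auto
  ultimately show "tendsto_mat X X\<^sub>0 F" by simp
  show "\<forall>\<^sub>F x in F. A x * X x = B x"
    using tendsto_imp_eventually_ne[OF det \<open>det L \<noteq> 0\<close>]
  proof eventually_elim
    case (elim x)
    have Ax: "A x \<in> carrier_mat n n" by (rule tendsto_mat_carrier[OF A L])
    have Bx: "B x \<in> carrier_mat n k" by (rule tendsto_mat_carrier[OF B]) (use L X\<^sub>0 in simp)
    have "A x * (adj_mat (A x) * B x) = det (A x) \<cdot>\<^sub>m B x"
      using adj_mat[OF Ax] Ax Bx
      by (simp flip: assoc_mult_mat add: mult_smult_assoc_mat[OF one_carrier_mat Bx])
    then have "A x * X x = inverse (det (A x)) \<cdot>\<^sub>m (det (A x) \<cdot>\<^sub>m B x)"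
      unfolding X_def using adj_mat(1)[OF Ax] Bx by (simp add: mult_smult_distrib[OF Ax, of _ k])
    also have "\<dots> = B x" using elim by (intro eq_matI) auto
    finally show ?case .
  qed
qed

lemma orthogonal_row_coefficients_near_identity:
  fixes M :: "'a \<Rightarrow> 'b::real_normed_field mat"
  assumes M: "tendsto_mat M (1\<^sub>m n) F" and "m < n"
  obtains c where "\<And>j. j < m \<Longrightarrow> (c j \<longlongrightarrow> 0) F"
    and "\<forall>\<^sub>F x in F. \<forall>l<m. (\<Sum>j=0..<m. c j x * M x $$ (l, j))
      + (\<Sum>j=m..<n. M x $$ (m, j) * M x $$ (l, j)) = 0"
proof -
  define G where "G x = mat m m (\<lambda>(l, j). M x $$ (l, j))" for x
  define b where "b x = mat m 1 (\<lambda>(l, _). - (\<Sum>j=m..<n. M x $$ (m, j) * M x $$ (l, j)))" for x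
  note M_index = tendsto_mat_index[OF M one_carrier_mat]
  have G: "tendsto_mat G (1\<^sub>m m) F"
    using M_index \<open>m < n\<close> by (auto simp: tendsto_mat_def G_def)
  have "((\<lambda>x. - (\<Sum>j=m..<n. M x $$ (m, j) * M x $$ (l, j))) \<longlongrightarrow> 0) F" if "l < m" for l
  proof -
    have "((\<lambda>x. - (\<Sum>j=m..<n. M x $$ (m, j) * M x $$ (l, j)))
        \<longlongrightarrow> - (\<Sum>j=m..<n. 1\<^sub>m n $$ (m, j) * 1\<^sub>m n $$ (l, j))) F"
      using that \<open>m < n\<close> by (intro tendsto_minus tendsto_sum tendsto_mult M_index) auto
    then show ?thesis using that \<open>m < n\<close> by simp
  qed
  then have b: "tendsto_mat b (1\<^sub>m m * 0\<^sub>m m 1) F"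
    by (simp add: tendsto_mat_def b_def)
  obtain C where C: "tendsto_mat C (0\<^sub>m m 1) F" and solution: "\<forall>\<^sub>F x in F. G x * C x = b x"
    by (rule tendsto_mat_solution[OF G b one_carrier_mat zero_carrier_mat]) simp_all
  have "\<forall>\<^sub>F x in F. \<forall>l<m. (\<Sum>j=0..<m. C x $$ (j, 0) * M x $$ (l, j))
      + (\<Sum>j=m..<n. M x $$ (m, j) * M x $$ (l, j)) = 0"
    using solution
  proof eventually_elim
    case (elim x)
    have "C x \<in> carrier_mat m 1" by (rule tendsto_mat_carrier[OF C zero_carrier_mat])
    then have "(\<Sum>j=0..<m. C x $$ (j, 0) * M x $$ (l, j)) = (G x * C x) $$ (l, 0)" if "l < m" for l
      using that by (simp add: scalar_prod_def G_def mult.commute)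
    then show ?case by (simp add: elim b_def)
  qed
  moreover have "((\<lambda>x. C x $$ (j, 0)) \<longlongrightarrow> 0) F" if "j < m" for j
    using tendsto_mat_index[OF C zero_carrier_mat that, of 0] that by simp
  ultimately show thesis using that[of "\<lambda>j x. C x $$ (j, 0)"] by blast
qed

lemma orthogonalize_row_near_identity:
  fixes M :: "'a \<Rightarrow> 'b::real_normed_field mat"
  assumes M: "tendsto_mat M (1\<^sub>m n) F" and "m < n"
  obtains M' where "tendsto_mat M' (1\<^sub>m n) F"
    and "\<And>x i j. i < n \<Longrightarrow> j < n \<Longrightarrow> i \<noteq> m \<or> i \<le> j \<Longrightarrow> M' x $$ (i, j) = M x $$ (i, j)"
    and "\<forall>\<^sub>F x in F. \<forall>l<m. row (M' x) m \<bullet> row (M' x) l = 0"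
proof -
  obtain c where c: "\<And>j. j < m \<Longrightarrow> (c j \<longlongrightarrow> 0) F"
    and solution: "\<forall>\<^sub>F x in F. \<forall>l<m. (\<Sum>j=0..<m. c j x * M x $$ (l, j))
      + (\<Sum>j=m..<n. M x $$ (m, j) * M x $$ (l, j)) = 0"
    by (rule orthogonal_row_coefficients_near_identity[OF assms]) blast
  define M' where "M' x = mat n n (\<lambda>(i, j). if i = m \<and> j < m then c j x else M x $$ (i, j))" for x
  have "((\<lambda>x. M' x $$ (i, j)) \<longlongrightarrow> 1\<^sub>m n $$ (i, j)) F" if "i < n" "j < n" for i j
    using that c[of j] tendsto_mat_index[OF M one_carrier_mat that]
    by (cases "i = m \<and> j < m") (auto simp: M'_def)
  then have "tendsto_mat M' (1\<^sub>m n) F"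
    by (simp add: tendsto_mat_def M'_def)
  moreover have "M' x $$ (i, j) = M x $$ (i, j)" if "i < n" "j < n" "i \<noteq> m \<or> i \<le> j" for x i j
    using that by (auto simp: M'_def)
  moreover have "\<forall>\<^sub>F x in F. \<forall>l<m. row (M' x) m \<bullet> row (M' x) l = 0"
    using solution
  proof eventually_elim
    case (elim x)
    have "row (M' x) m \<bullet> row (M' x) l = (\<Sum>j=0..<m. c j x * M x $$ (l, j))
        + (\<Sum>j=m..<n. M x $$ (m, j) * M x $$ (l, j))" if "l < m" for l
    proof -
      have "row (M' x) m \<bullet> row (M' x) l = (\<Sum>j=0..<n. M' x $$ (m, j) * M' x $$ (l, j))"
        using that \<open>m < n\<close> by (simp add: scalar_prod_def M'_def)
      also have "\<dots> = (\<Sum>j=0..<m. M' x $$ (m, j) * M' x $$ (l, j))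
          + (\<Sum>j=m..<n. M' x $$ (m, j) * M' x $$ (l, j))"
        using \<open>m < n\<close> by (simp add: sum.atLeastLessThan_concat)
      finally show ?thesis using that \<open>m < n\<close> by (simp add: M'_def)
    qed
    with elim show ?case by simp
  qed
  ultimately show thesis by (rule that)
qed

definition first_rows_orthogonal :: "nat \<Rightarrow> 'a::semiring_0 mat \<Rightarrow> bool" where
  "first_rows_orthogonal m A \<longleftrightarrow> (\<forall>i<m. \<forall>l<i. row A i \<bullet> row A l = 0)"

lemma orthogonalize_rows_near_identity:
  fixes N :: "'a \<Rightarrow> 'b::real_normed_field mat"
  assumes "tendsto_mat N (1\<^sub>m n) F" and "m \<le> n"
  shows "\<exists>M. tendsto_mat M (1\<^sub>m n) F
    \<and> (\<forall>x i j. i \<le> j \<longrightarrow> j < n \<longrightarrow> M x $$ (i, j) = N x $$ (i, j))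
    \<and> (\<forall>\<^sub>F x in F. first_rows_orthogonal m (M x))"
  using \<open>m \<le> n\<close>
proof (induction m)
  case 0
  show ?case using assms(1) by (auto simp: first_rows_orthogonal_def)
next
  case (Suc m)
  then obtain M where M: "tendsto_mat M (1\<^sub>m n) F"
    and upper: "\<And>x i j. i \<le> j \<Longrightarrow> j < n \<Longrightarrow> M x $$ (i, j) = N x $$ (i, j)"
    and orth: "\<forall>\<^sub>F x in F. first_rows_orthogonal m (M x)"
    by auto
  have "m < n" using Suc.prems by simp
  obtain M' where M': "tendsto_mat M' (1\<^sub>m n) F"
    and unchanged: "\<And>x i j. i < n \<Longrightarrow> j < n \<Longrightarrow> i \<noteq> m \<or> i \<le> j
      \<Longrightarrow> M' x $$ (i, j) = M x $$ (i, j)"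
    and orth_row: "\<forall>\<^sub>F x in F. \<forall>l<m. row (M' x) m \<bullet> row (M' x) l = 0"
    by (rule orthogonalize_row_near_identity[OF M \<open>m < n\<close>]) blast
  have rows: "row (M' x) i = row (M x) i" if "i < m" for x i
    using that \<open>m < n\<close> unchanged tendsto_mat_carrier[OF M one_carrier_mat, of x]
      tendsto_mat_carrier[OF M' one_carrier_mat, of x]
    by (intro eq_vecI) auto
  have "\<forall>\<^sub>F x in F. first_rows_orthogonal (Suc m) (M' x)"
    using orth orth_row by eventually_elim (auto simp: first_rows_orthogonal_def less_Suc_eq rows)
  moreover have "M' x $$ (i, j) = N x $$ (i, j)" if "i \<le> j" "j < n" for x i j
    using that unchanged upper by simp
  ultimately show ?case using M' by blast
qed

lemma eventually_orthogonal_mat_transpose: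
  fixes L :: "'b::{real_normed_algebra_1, comm_ring_1} mat"
  assumes M: "tendsto_mat M L F" and L: "L \<in> carrier_mat m n" "L * L\<^sup>T = 1\<^sub>m m"
    and orth: "\<forall>\<^sub>F x in F. first_rows_orthogonal m (M x)"
  shows "\<forall>\<^sub>F x in F. orthogonal_mat (M x)\<^sup>T"
proof -
  note M_carrier = tendsto_mat_carrier[OF M L(1)]
  have Gram: "tendsto_mat (\<lambda>x. M x * (M x)\<^sup>T) (1\<^sub>m m) F"
    using tendsto_mat_mult[OF M tendsto_mat_transpose[OF M]] L by simp
  have "\<forall>\<^sub>F x in F. row (M x) i \<bullet> row (M x) i \<noteq> 0" if "i < m" for i
  proof -
    have "((\<lambda>x. (M x * (M x)\<^sup>T) $$ (i, i)) \<longlongrightarrow> 1) F"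
      using tendsto_mat_index[OF Gram one_carrier_mat that that] that by simp
    then have "((\<lambda>x. row (M x) i \<bullet> row (M x) i) \<longlongrightarrow> 1) F"
      using M_carrier that by (simp add: carrier_matD[OF M_carrier])
    then show ?thesis by (rule tendsto_imp_eventually_ne) simp
  qed
  then have "\<forall>\<^sub>F x in F. \<forall>i\<in>{..<m}. row (M x) i \<bullet> row (M x) i \<noteq> 0"
    by (intro eventually_ball_finite) auto
  with orth show ?thesis
  proof eventually_elim
    case (elim x)
    show ?case
    proof (rule orthogonal_matI)
      fix i l assume "i < dim_col (M x)\<^sup>T" "l < dim_col (M x)\<^sup>T"
      then have il: "i < m" "l < m" using M_carrier[of x] by auto
      then have "row (M x) i \<bullet> row (M x) l = 0 \<longleftrightarrow> i \<noteq> l"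
        using elim M_carrier[of x] comm_scalar_prod[of "row (M x) i" n "row (M x) l"]
        by (cases i l rule: linorder_cases) (auto simp: first_rows_orthogonal_def)
      then show "col (M x)\<^sup>T i \<bullet> col (M x)\<^sup>T l = 0 \<longleftrightarrow> i \<noteq> l"
        using il M_carrier[of x] by simp
    qed
  qed
qed

lemma orthogonal_mat_transpose_mult_iff:
  fixes M Q :: "'a::comm_ring_1 mat"
  assumes M: "M \<in> carrier_mat m n" and Q: "Q \<in> carrier_mat n k" "Q * Q\<^sup>T = 1\<^sub>m n"
  shows "orthogonal_mat (M * Q)\<^sup>T \<longleftrightarrow> orthogonal_mat M\<^sup>T"
proof -
  have "M * Q * (M * Q)\<^sup>T = M * (Q * (Q\<^sup>T * M\<^sup>T))"
    using M Q(1) by (simp add: transpose_mult[OF M Q(1)] assoc_mult_mat[of _ m n _ k _ m])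
  also have "Q * (Q\<^sup>T * M\<^sup>T) = M\<^sup>T"
    using M Q by (simp flip: assoc_mult_mat[of _ n k _ n _ m])
  finally show ?thesis using M by (simp add: orthogonal_mat_def)
qed

lemma orthogonalize_rows_near_orthonormal_mat:
  assumes A: "tendsto_mat A Q F" and Q: "orthonormal_mat Q" "Q \<in> carrier_mat n n"
  obtains B where "tendsto_mat B Q F" and "\<forall>\<^sub>F x in F. orthogonal_mat (B x)\<^sup>T"
    and "\<And>x i j. i < n \<Longrightarrow> j < n \<Longrightarrow> (\<And>k. k < i \<Longrightarrow> Q $$ (k, j) = 0)
      \<Longrightarrow> B x $$ (i, j) = A x $$ (i, j)"
proof -
  have QQT: "Q * Q\<^sup>T = 1\<^sub>m n" using Q by (auto simp: orthonormal_mat_def)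
  have QTQ: "Q\<^sup>T * Q = 1\<^sub>m n"
    by (rule mat_mult_left_right_inverse[OF Q(2) _ QQT]) (use Q(2) in simp)
  define N where "N x = A x * Q\<^sup>T" for x
  have N: "tendsto_mat N (1\<^sub>m n) F"
    using tendsto_mat_mult[OF A tendsto_mat_const, of "Q\<^sup>T"] Q(2) by (simp add: N_def[abs_def] QQT)
  note A_carrier = tendsto_mat_carrier[OF A Q(2)]
    and N_carrier = tendsto_mat_carrier[OF N one_carrier_mat]
  have A_eq: "A x = N x * Q" for x
    using A_carrier[of x] Q(2) by (simp add: N_def assoc_mult_mat[of _ n n _ n _ n] QTQ)
  obtain M where M: "tendsto_mat M (1\<^sub>m n) F"
    and upper: "\<And>x i j. i \<le> j \<Longrightarrow> j < n \<Longrightarrow> M x $$ (i, j) = N x $$ (i, j)"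
    and orth: "\<forall>\<^sub>F x in F. first_rows_orthogonal n (M x)"
    using orthogonalize_rows_near_identity[OF N order.refl] by blast
  note M_carrier = tendsto_mat_carrier[OF M one_carrier_mat]
  have "tendsto_mat (\<lambda>x. M x * Q) Q F"
    using tendsto_mat_mult[OF M tendsto_mat_const, of Q] Q(2) by simp
  moreover have "\<forall>\<^sub>F x in F. orthogonal_mat (M x * Q)\<^sup>T"
    using eventually_orthogonal_mat_transpose[OF M one_carrier_mat _ orth]
    by (simp add: orthogonal_mat_transpose_mult_iff[OF M_carrier Q(2) QQT])
  moreover have "(M x * Q) $$ (i, j) = A x $$ (i, j)"
    if ij: "i < n" "j < n" and zeros: "\<And>k. k < i \<Longrightarrow> Q $$ (k, j) = 0" for x i j
  proof -
    have "M x $$ (i, k) * Q $$ (k, j) = N x $$ (i, k) * Q $$ (k, j)" if "k < n" for k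
      using zeros upper that by (cases "k < i") auto
    then have "(\<Sum>k=0..<n. M x $$ (i, k) * Q $$ (k, j)) = (\<Sum>k=0..<n. N x $$ (i, k) * Q $$ (k, j))"
      by (intro sum.cong) auto
    then show ?thesis
      using ij M_carrier[of x] N_carrier[of x] Q(2) by (simp add: A_eq scalar_prod_def)
  qed
  ultimately show thesis by (rule that)
qed

lemma scalar_prod_self_nonneg: "0 \<le> v \<bullet> v" for v :: "'a::linordered_idom vec"
  by (simp add: scalar_prod_def sum_nonneg)

definition normalize_rows :: "real mat \<Rightarrow> real mat" where
  "normalize_rows A = mat (dim_row A) (dim_col A)
     (\<lambda>(i, j). A $$ (i, j) / sqrt (row A i \<bullet> row A i))"

lemma orthonormal_mat_normalize_rows:
  assumes A: "A \<in> carrier_mat n n" and orth: "orthogonal_mat A\<^sup>T"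
  shows "orthonormal_mat (normalize_rows A)"
proof -
  have row_orth: "row A i \<bullet> row A l = 0 \<longleftrightarrow> i \<noteq> l" if "i < n" "l < n" for i l
    using orthogonal_matD[OF orth, of i l] that A by simp
  have "normalize_rows A * (normalize_rows A)\<^sup>T = 1\<^sub>m n"
  proof (rule eq_matI)
    fix i l assume "i < dim_row (1\<^sub>m n)" "l < dim_col (1\<^sub>m n)"
    then have il: "i < n" "l < n" by auto
    have "(normalize_rows A * (normalize_rows A)\<^sup>T) $$ (i, l)
        = row A i \<bullet> row A l / (sqrt (row A i \<bullet> row A i) * sqrt (row A l \<bullet> row A l))"
      using il A by (simp add: normalize_rows_def scalar_prod_def sum_divide_distrib)
    also have "\<dots> = 1\<^sub>m n $$ (i, l)"
      using row_orth[OF il] row_orth[OF il(1) il(1)] il scalar_prod_self_nonneg[of "row A i"]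
      by (cases "i = l") auto
    finally show "(normalize_rows A * (normalize_rows A)\<^sup>T) $$ (i, l) = 1\<^sub>m n $$ (i, l)" .
  qed (use A in \<open>auto simp: normalize_rows_def\<close>)
  then show ?thesis using A by (simp add: orthonormal_mat_def normalize_rows_def)
qed

lemma sgn_mat_normalize_rows:
  assumes "\<And>i. i < dim_row A \<Longrightarrow> row A i \<bullet> row A i \<noteq> 0"
  shows "sgn_mat (normalize_rows A) = sgn_mat A"
proof -
  have "row A i \<bullet> row A i > 0" if "i < dim_row A" for i
    using assms[OF that] scalar_prod_self_nonneg[of "row A i"] by simp
  then show ?thesis
    by (intro eq_matI) (auto simp: sgn_mat_def normalize_rows_def sgn_divide)
qed

lemma allows_orthogonality_sgn_mat:
  assumes "A \<in> carrier_mat n n" and "orthogonal_mat A\<^sup>T"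
  shows "allows_orthogonality (sgn_mat A)"
proof -
  have "row A i \<bullet> row A i \<noteq> 0" if "i < dim_row A" for i
    using orthogonal_matD[OF assms(2), of i i] that by simp
  with orthonormal_mat_normalize_rows[OF assms] show ?thesis
    unfolding allows_orthogonality_def using sgn_mat_normalize_rows by blast
qed

lemma eventually_sgn_eq:
  fixes f :: "'a \<Rightarrow> 'b::{linordered_idom, order_topology}"
  assumes "(f \<longlongrightarrow> l) F" and "l \<noteq> 0"
  shows "\<forall>\<^sub>F x in F. sgn (f x) = sgn l"
proof (cases l "0::'b" rule: linorder_cases)
  case less
  with order_tendstoD(2)[OF assms(1), of 0] show ?thesis by (auto elim!: eventually_mono)
next
  case greater
  with order_tendstoD(1)[OF assms(1), of 0] show ?thesis by (auto elim!: eventually_mono)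
qed (use assms(2) in simp)

lemma sgn_sign_pattern:
  assumes "sign_pattern R" "i < dim_row R" "j < dim_col R"
  shows "sgn (R $$ (i, j)) = R $$ (i, j)"
proof -
  have "R $$ (i, j) \<in> elements_mat R" using assms by auto
  then show ?thesis using assms(1) by (auto simp: sign_pattern_def)
qed

lemma eventually_sgn_mat_eq_overlay:
  assumes B: "tendsto_mat B Q (at_right 0)" and Q: "Q \<in> carrier_mat m n"
    and R: "R \<in> carrier_mat m n" "sign_pattern R"
    and zeros: "\<And>e i j. i < m \<Longrightarrow> j < n \<Longrightarrow> Q $$ (i, j) = 0 \<Longrightarrow> B e $$ (i, j) = e * R $$ (i, j)"
  shows "\<forall>\<^sub>F e in at_right 0. sgn_mat (B e) = overlay (sgn_mat Q) R"
proof -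
  let ?T = "overlay (sgn_mat Q) R"
  have T: "?T $$ (i, j) = (if Q $$ (i, j) = 0 then R $$ (i, j) else sgn (Q $$ (i, j)))"
    if "i < m" "j < n" for i j
    using that Q by (simp add: overlay_def sgn_mat_def sgn_zero_iff)
  have "\<forall>\<^sub>F e in at_right 0. sgn (B e $$ (i, j)) = ?T $$ (i, j)" if "i < m" "j < n" for i j
  proof (cases "Q $$ (i, j) = 0")
    case True
    have "\<forall>\<^sub>F e in at_right (0::real). e > 0" by (rule eventually_at_right_less)
    then show ?thesis
    proof eventually_elim
      case (elim e)
      then show ?case
        using True that R by (simp add: zeros T sgn_mult sgn_sign_pattern)
    qed
  next
    case False
    then show ?thesis
      using eventually_sgn_eq[OF tendsto_mat_index[OF B Q that]] T that by simp
  qed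
  then have "\<forall>\<^sub>F e in at_right 0. \<forall>i\<in>{..<m}. \<forall>j\<in>{..<n}. sgn (B e $$ (i, j)) = ?T $$ (i, j)"
    by (intro eventually_ball_finite ballI) auto
  then show ?thesis
  proof eventually_elim
    case (elim e)
    then show ?case
      using tendsto_mat_carrier[OF B Q, of e] Q
      by (intro eq_matI) (auto simp: sgn_mat_def overlay_def)
  qed
qed

definition staircase_mat :: "'a::zero mat \<Rightarrow> bool" where
  "staircase_mat A \<longleftrightarrow> (\<forall>i<dim_row A. \<forall>j<dim_col A. A $$ (i, j) = 0 \<longrightarrow> (\<forall>k<i. A $$ (k, j) = 0))"

theorem super_pattern_staircase_allows_orthogonality:
  assumes Q: "orthonormal_mat Q" "staircase_mat Q" and "super_pattern T (sgn_mat Q)"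
  shows "allows_orthogonality T"
proof -
  define n where "n = dim_row Q"
  have Q_carrier: "Q \<in> carrier_mat n n"
    using Q(1) by (auto simp: n_def orthonormal_mat_def)
  obtain R where R: "R \<in> carrier_mat n n" "sign_pattern R" and T: "T = overlay (sgn_mat Q) R"
    using \<open>super_pattern T (sgn_mat Q)\<close> Q_carrier by (auto simp: super_pattern_def sgn_mat_def)
  define A where "A e = Q + e \<cdot>\<^sub>m R" for e
  have "tendsto_mat A (Q + 0 \<cdot>\<^sub>m R) (at_right 0)"
    unfolding A_def using Q_carrier R
    by (intro tendsto_mat_add tendsto_mat_smult tendsto_mat_const tendsto_ident_at) auto
  moreover have "Q + 0 \<cdot>\<^sub>m R = Q" using Q_carrier R by (intro eq_matI) auto
  ultimately have A: "tendsto_mat A Q (at_right 0)" by simp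
  obtain B where B: "tendsto_mat B Q (at_right 0)"
    and orth: "\<forall>\<^sub>F e in at_right 0. orthogonal_mat (B e)\<^sup>T"
    and unchanged: "\<And>e i j. i < n \<Longrightarrow> j < n \<Longrightarrow> (\<And>k. k < i \<Longrightarrow> Q $$ (k, j) = 0)
      \<Longrightarrow> B e $$ (i, j) = A e $$ (i, j)"
    by (rule orthogonalize_rows_near_orthonormal_mat[OF A Q(1) Q_carrier]) blast
  have "Q $$ (k, j) = 0" if "i < n" "j < n" "Q $$ (i, j) = 0" "k < i" for i j k
    using Q(2) that unfolding staircase_mat_def carrier_matD[OF Q_carrier] by blast
  then have "B e $$ (i, j) = A e $$ (i, j)" if "i < n" "j < n" "Q $$ (i, j) = 0" for e i j
    using that by (intro unchanged) blast+
  then have "B e $$ (i, j) = e * R $$ (i, j)" if "i < n" "j < n" "Q $$ (i, j) = 0" for e i j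
    using that Q_carrier R by (simp add: A_def)
  then have "\<forall>\<^sub>F e in at_right 0. sgn_mat (B e) = T"
    unfolding T by (rule eventually_sgn_mat_eq_overlay[OF B Q_carrier R])
  with orth have "\<forall>\<^sub>F e in at_right 0. orthogonal_mat (B e)\<^sup>T \<and> sgn_mat (B e) = T"
    by (rule eventually_conj)
  then obtain e where "orthogonal_mat (B e)\<^sup>T" "sgn_mat (B e) = T"
    using eventually_happens'[OF trivial_limit_at_right_real] by blast
  then show ?thesis
    using allows_orthogonality_sgn_mat[OF tendsto_mat_carrier[OF B Q_carrier]] by metis
qed

theorem corollary5p2:
  fixes n :: nat and Q :: "real mat"
  assumes "n \<ge> 2"
    and "Q \<in> carrier_mat n n"
    and "orthonormal_mat Q"
    and "\<And>i j. i < n \<Longrightarrow> j < n \<Longrightarrow> Q $$ (i, j) \<noteq> 0 \<longleftrightarrow> j \<le> i + 1"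
  shows "\<forall>T. super_pattern T (sgn_mat Q) \<longrightarrow> allows_orthogonality T"
proof -
  have "Q $$ (k, j) = 0" if "i < n" "j < n" "Q $$ (i, j) = 0" "k < i" for i j k
  proof -
    have "i + 1 < j" using assms(4)[of i j] that by auto
    then have "\<not> j \<le> k + 1" using \<open>k < i\<close> by simp
    then show ?thesis using assms(4)[of k j] that by auto
  qed
  then have "staircase_mat Q"
    unfolding staircase_mat_def carrier_matD[OF assms(2)] by blast
  then show ?thesis
    using super_pattern_staircase_allows_orthogonality assms(3) by blast
qed

end
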